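(* Let $(P,\le,{}',0,1)$ be a Boolean poset satisfying the Ascending Chain Condition and the Descending Chain Condition, let $T(x,y,z):=\operatorname{Min}U\big(\operatorname{Max}L(x,z),\operatorname{Max}L(x,y',z'),\operatorname{Max}L(x',y',z)\big)$ for $x,y,z\in P$, and let $\Theta$ be a reflexive binary relation on $P$ which is compatible with the binary operators $\operatorname{Max}L$ and $\operatorname{Min}U$ and with the unary operation $'$. Then $\Theta$ is a congruence on $(P,\le,{}',0,1)$.
   Context: For a poset $(P,\le)$ and $A\subseteq P$ let $L(A)=\{x\mid x\le y\ \forall y\in A\}$, $U(A)=\{x\mid y\le x\ \forall y\in A\}$; write $L(x,y)=L(\{x,y\})$, $L(x,y,z)$, $U(A,B,C)=U(A\cup B\cup C)$, $LU(A)=L(U(A))$, etc.; $\operatorname{Max}A$, $\operatorname{Min}A$ are the sets of maximal, minimal elements. A poset is distributive if $L(U(x,y),z)=LU(L(x,z),L(y,z))$ for all $x,y,z$. A complementation on a bounded poset $(P,\le,0,1)$ is a unary operation $'$ with $U(x,x')=\{1\}$ and $L(x,x')=\{0\}$; a Boolean poset is a distributive bounded poset with a complementation. A binary relation $R$ is compatible with a map $Q\colon P^2\to2^P$ if whenever $(a_1,b_1),(a_2,b_2)\in R$ there exist $a\in Q(a_1,a_2)$, $b\in Q(b_1,b_2)$ with $(a,b)\in R$; it is compatible with $'$ if $(a,b)\in R$ implies $(a',b')\in R$. A congruence on a Boolean poset is an equivalence relation compatible with $(x,y)\mapsto\operatorname{Max}L(x,y)$, $(x,y)\mapsto\operatorname{Min}U(x,y)$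 and $'$. *)

theory Defs
  imports Main
begin

text \<open>
  A bounded poset is a type of class \<open>order_bot\<close> and \<open>order_top\<close>: the underlying set is the
  whole type, and the constants 0 and 1 are \<open>bot\<close> and \<open>top\<close>.
\<close>

definition lower_bounds :: "'a::order set \<Rightarrow> 'a set" where
  "lower_bounds A = {x. \<forall>y\<in>A. x \<le> y}"

definition upper_bounds :: "'a::order set \<Rightarrow> 'a set" where
  "upper_bounds A = {x. \<forall>y\<in>A. y \<le> x}"

definition maximal_elems :: "'a::order set \<Rightarrow> 'a set" where
  "maximal_elems A = {x \<in> A. \<not> (\<exists>y\<in>A. x < y)}"

definition minimal_elems :: "'a::order set \<Rightarrow> 'a set" where
  "minimal_elems A = {x \<in> A. \<not> (\<exists>y\<in>A. y < x)}"

definition distributive_poset :: "'a::order itself \<Rightarrow> bool" where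
  "distributive_poset (_ :: 'a itself) \<longleftrightarrow>
    (\<forall>x y z :: 'a.
      lower_bounds (upper_bounds {x, y} \<union> {z}) =
      lower_bounds (upper_bounds (lower_bounds {x, z} \<union> lower_bounds {y, z})))"

definition complementation :: "('a::{order_bot, order_top} \<Rightarrow> 'a) \<Rightarrow> bool" where
  "complementation c \<longleftrightarrow>
    (\<forall>x. upper_bounds {x, c x} = {top} \<and> lower_bounds {x, c x} = {bot})"

definition boolean_poset :: "('a::{order_bot, order_top} \<Rightarrow> 'a) \<Rightarrow> bool" where
  "boolean_poset c \<longleftrightarrow> distributive_poset TYPE('a) \<and> complementation c"

definition ascending_chain_condition :: "'a::order itself \<Rightarrow> bool" where
  "ascending_chain_condition (_ :: 'a itself) \<longleftrightarrow>
    \<not> (\<exists>f :: nat \<Rightarrow> 'a. \<forall>i. f i < f (Suc i))"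

definition descending_chain_condition :: "'a::order itself \<Rightarrow> bool" where
  "descending_chain_condition (_ :: 'a itself) \<longleftrightarrow>
    \<not> (\<exists>f :: nat \<Rightarrow> 'a. \<forall>i. f (Suc i) < f i)"

definition MaxL :: "'a::order \<Rightarrow> 'a \<Rightarrow> 'a set" where
  "MaxL x y = maximal_elems (lower_bounds {x, y})"

definition MinU :: "'a::order \<Rightarrow> 'a \<Rightarrow> 'a set" where
  "MinU x y = minimal_elems (upper_bounds {x, y})"

definition compatible_binary :: "('a \<times> 'a) set \<Rightarrow> ('a \<Rightarrow> 'a \<Rightarrow> 'a set) \<Rightarrow> bool" where
  "compatible_binary R Q \<longleftrightarrow>
    (\<forall>a1 b1 a2 b2. (a1, b1) \<in> R \<longrightarrow> (a2, b2) \<in> R \<longrightarrow>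
      (\<exists>a \<in> Q a1 a2. \<exists>b \<in> Q b1 b2. (a, b) \<in> R))"

definition compatible_unary :: "('a \<times> 'a) set \<Rightarrow> ('a \<Rightarrow> 'a) \<Rightarrow> bool" where
  "compatible_unary R c \<longleftrightarrow> (\<forall>a b. (a, b) \<in> R \<longrightarrow> (c a, c b) \<in> R)"

definition boolean_poset_congruence ::
  "('a::{order_bot, order_top} \<Rightarrow> 'a) \<Rightarrow> ('a \<times> 'a) set \<Rightarrow> bool" where
  "boolean_poset_congruence c R \<longleftrightarrow>
    equiv UNIV R \<and> compatible_binary R MaxL \<and> compatible_binary R MinU \<and> compatible_unary R c"

end

theory Submission
  imports Defs
begin

text \<open>
  The ideal \<open>I = {p. (p, 0) \<in> \<Theta>}\<close> is directed, because \<open>\<Theta>\<close> is compatible with \<open>Min U\<close>; by the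
  Ascending Chain Condition it has a greatest element \<open>e\<close>. Separating elements of the Boolean
  poset by nonzero elements shows that \<open>(a, b) \<in> \<Theta>\<close> implies \<open>U(a, e) = U(b, e)\<close>. Applied to
  \<open>(m, y) \<in> \<Theta>\<close> with \<open>m \<in> Min U(y, e)\<close>, this makes \<open>m\<close> the supremum of \<open>y\<close> and \<open>e\<close>. Hence
  \<open>U(y, e) = U(z, e)\<close> means that \<open>y\<close> and \<open>z\<close> have the same \<open>m\<close>, and taking \<open>Max L\<close> of \<open>(y, m)\<close>
  and \<open>(m, z)\<close> gives \<open>(y, z) \<in> \<Theta>\<close>. So \<open>\<Theta>\<close> is the kernel of \<open>y \<mapsto> U(y, e)\<close>.
\<close>

section \<open>Degenerate values of \<open>MaxL\<close> and \<open>MinU\<close>, compatibility,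
  chains\<close>

lemma MaxL_eq_left: "x \<le> y \<Longrightarrow> MaxL x y = {x}"
  by (auto simp: MaxL_def maximal_elems_def lower_bounds_def order.strict_iff_order)

lemma MaxL_eq_right: "y \<le> x \<Longrightarrow> MaxL x y = {y}"
  by (auto simp: MaxL_def maximal_elems_def lower_bounds_def order.strict_iff_order)

lemma MinU_eq_right: "x \<le> y \<Longrightarrow> MinU x y = {y}"
  by (auto simp: MinU_def minimal_elems_def upper_bounds_def order.strict_iff_order)

lemma MinU_upper: "m \<in> MinU x y \<Longrightarrow> x \<le> m \<and> y \<le> m"
  by (auto simp: MinU_def minimal_elems_def upper_bounds_def)

lemma MinU_eq_lub:
  assumes "upper_bounds {x, y} = upper_bounds {m}"
  shows "MinU x y = {m}"
  using assms
  by (auto simp: MinU_def minimal_elems_def upper_bounds_def order.strict_iff_order)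

lemma MaxL_disjoint:
  fixes x y :: "'a::{order_bot, order_top}"
  shows "lower_bounds {x, y} = {bot} \<Longrightarrow> MaxL x y = {bot}"
  by (auto simp: MaxL_def maximal_elems_def)

lemma compatible_binaryE:
  assumes "compatible_binary R Q" "(a1, b1) \<in> R" "(a2, b2) \<in> R"
  obtains a b where "a \<in> Q a1 a2" "b \<in> Q b1 b2" "(a, b) \<in> R"
  using assms unfolding compatible_binary_def by blast

text \<open>Compatibility only promises some related pair of values; when both value sets are
  singletons, that pair is forced.\<close>

lemma compatible_binary_singletons:
  assumes "compatible_binary R Q" "(a1, b1) \<in> R" "(a2, b2) \<in> R" "Q a1 a2 = {a}" "Q b1 b2 = {b}"
  shows "(a, b) \<in> R"
  using assms unfolding compatible_binary_def by fastforce

lemma acc_maximal_element: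
  assumes "ascending_chain_condition TYPE('a::order)" "(x :: 'a) \<in> A"
  shows "\<exists>m\<in>A. \<forall>y\<in>A. \<not> m < y"
proof (rule ccontr)
  assume "\<not> ?thesis"
  then have "\<forall>m. \<exists>y. m \<in> A \<longrightarrow> y \<in> A \<and> m < y" by blast
  then obtain s where s: "\<And>m. m \<in> A \<Longrightarrow> s m \<in> A \<and> m < s m" by metis
  \<comment> \<open>Iterating \<open>s\<close> from \<open>x\<close> stays in \<open>A\<close> and
    climbs strictly forever.\<close>
  have "(s ^^ n) x \<in> A" for n
    by (induction n) (use assms(2) s in auto)
  then have "\<forall>n. (s ^^ n) x < (s ^^ Suc n) x" using s by simp
  then show False using assms(1) unfolding ascending_chain_condition_def
    by (auto dest: spec[of _ "\<lambda>n. (s ^^ n) x"])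
qed

section \<open>Complements and separation in a Boolean poset\<close>

context
  fixes c :: "'a::{order_bot, order_top} \<Rightarrow> 'a"
  assumes bp: "boolean_poset c"
begin

lemma lower_bounds_compl: "lower_bounds {x, c x} = {bot}"
  and upper_bounds_compl: "upper_bounds {x, c x} = {top}"
  using bp by (auto simp: boolean_poset_def complementation_def)

lemma distributive:
  "lower_bounds (upper_bounds {x, y} \<union> {z :: 'a}) =
   lower_bounds (upper_bounds (lower_bounds {x, z} \<union> lower_bounds {y, z}))"
  using bp by (simp add: boolean_poset_def distributive_poset_def)

text \<open>Distribute \<open>y\<close> over the pair \<open>x\<close>, \<open>c x\<close>: the only
  upper bound of the pair is \<open>top\<close>, and the part of \<open>y\<close> below
  \<open>x\<close> is just \<open>bot\<close>, so \<open>c x\<close> bounds everything that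
  remains.\<close>

lemma disjoint_imp_le_compl:
  assumes "lower_bounds {x, y} = {bot}"
  shows "y \<le> c x"
proof -
  have "y \<in> lower_bounds (upper_bounds {x, c x} \<union> {y})"
    unfolding upper_bounds_compl by (simp add: lower_bounds_def)
  then have "y \<in> lower_bounds (upper_bounds ({bot} \<union> lower_bounds {c x, y}))"
    unfolding distributive assms .
  moreover have "c x \<in> upper_bounds ({bot} \<union> lower_bounds {c x, y})"
    by (auto simp: upper_bounds_def lower_bounds_def)
  ultimately show ?thesis by (auto simp: lower_bounds_def)
qed

lemma codisjoint_imp_compl_le:
  assumes "upper_bounds {x, y} = {top}"
  shows "c y \<le> x"
proof -
  have "c y \<in> lower_bounds (upper_bounds {x, y} \<union> {c y})"
    unfolding assms by (simp add: lower_bounds_def)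
  then have "c y \<in> lower_bounds (upper_bounds (lower_bounds {x, c y} \<union> {bot}))"
    unfolding distributive lower_bounds_compl .
  moreover have "x \<in> upper_bounds (lower_bounds {x, c y} \<union> {bot})"
    by (auto simp: upper_bounds_def lower_bounds_def)
  ultimately show ?thesis by (auto simp: lower_bounds_def)
qed

lemma compl_compl: "c (c x) = x"
proof (rule antisym)
  show "c (c x) \<le> x" by (rule codisjoint_imp_compl_le[OF upper_bounds_compl])
  have "lower_bounds {c x, x} = {bot}"
    using lower_bounds_compl[of x] by (simp add: insert_commute)
  then show "x \<le> c (c x)" by (rule disjoint_imp_le_compl)
qed

lemma compl_top: "c top = bot"
  using lower_bounds_compl[of top] by (auto simp: lower_bounds_def)

text \<open>If \<open>x\<close> and \<open>c y\<close> were disjoint, then \<open>x\<close> would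
  lie below \<open>c (c y) = y\<close>.\<close>

lemma separating_element:
  assumes "\<not> x \<le> y"
  obtains t where "t \<noteq> bot" "t \<le> x" "t \<le> c y"
proof -
  have "lower_bounds {c y, x} \<noteq> {bot}"
    using disjoint_imp_le_compl[of "c y" x] assms by (auto simp: compl_compl)
  moreover have "bot \<in> lower_bounds {c y, x}" by (simp add: lower_bounds_def)
  ultimately obtain t where "t \<in> lower_bounds {c y, x}" "t \<noteq> bot" by blast
  then show thesis by (auto simp: lower_bounds_def intro: that)
qed

lemma le_and_le_compl_imp_bot:
  assumes "t \<le> u" "t \<le> c u"
  shows "t = bot"
proof -
  have "t \<in> lower_bounds {u, c u}" using assms by (simp add: lower_bounds_def)
  then show ?thesis by (simp add: lower_bounds_compl)
qed

lemma le_compl_imp_disjoint: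
  assumes "b \<le> u" "t \<le> c u"
  shows "lower_bounds {b, t} = {bot}"
proof -
  have "x = bot" if "x \<le> b" "x \<le> t" for x
    using le_and_le_compl_imp_bot[OF order_trans[OF that(1) assms(1)] order_trans[OF that(2) assms(2)]] .
  then show ?thesis by (auto simp: lower_bounds_def)
qed

text \<open>The common lower bounds of \<open>a\<close> and \<open>c b\<close> stand in for the
  difference of \<open>a\<close> and \<open>b\<close>, which need not exist as an element. Once
  \<open>e\<close> absorbs them all, \<open>b\<close> and \<open>e\<close> together bound as much as
  \<open>a\<close> does.\<close>

lemma upper_bounds_mono_of_difference:
  assumes "\<And>t. t \<le> a \<Longrightarrow> t \<le> c b \<Longrightarrow> t \<le> e"
  shows "upper_bounds {b, e} \<subseteq> upper_bounds {a, e}"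
proof
  fix u assume "u \<in> upper_bounds {b, e}"
  then have u: "b \<le> u" "e \<le> u" by (auto simp: upper_bounds_def)
  have "a \<le> u"
  proof (rule ccontr)
    assume "\<not> a \<le> u"
    then obtain t where t: "t \<noteq> bot" "t \<le> a" "t \<le> c u" by (rule separating_element)
    \<comment> \<open>As \<open>b\<close> is below \<open>u\<close>, the separating \<open>t\<close>
      is disjoint from \<open>b\<close>, so it belongs to the difference and falls under
      \<open>e\<close>, hence under \<open>u\<close>.\<close>
    have "lower_bounds {b, t} = {bot}"
      by (rule le_compl_imp_disjoint[OF u(1) t(3)])
    then have "t \<le> c b" by (rule disjoint_imp_le_compl)
    then have "t \<le> u" using assms t(2) u(2) by (blast intro: order_trans)
    then show False using le_and_le_compl_imp_bot t by blast
  qed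
  then show "u \<in> upper_bounds {a, e}" using u by (simp add: upper_bounds_def)
qed

section \<open>Reflexive compatible relations\<close>

context
  fixes \<Theta> :: "('a \<times> 'a) set"
  assumes refl: "refl \<Theta>"
    and maxL: "compatible_binary \<Theta> MaxL"
    and minU: "compatible_binary \<Theta> MinU"
    and compl: "compatible_unary \<Theta> c"
begin

lemma reflI: "(x, x) \<in> \<Theta>"
  using refl by (simp add: refl_on_def)

text \<open>Joining both sides with \<open>c t\<close> turns \<open>bot\<close> into
  \<open>c t\<close> and \<open>t\<close> into \<open>top\<close>; complementing then gives the pair
  in reverse order.\<close>

lemma related_bot_commute: "(bot, t) \<in> \<Theta> \<longleftrightarrow> (t, bot) \<in> \<Theta>"
proof -
  have 1: "MinU t (c t) = {top}"
    by (rule MinU_eq_lub) (simp add: upper_bounds_compl, auto simp: upper_bounds_def top_unique)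
  have 2: "MinU bot (c t) = {c t}" by (simp add: MinU_eq_right)
  show ?thesis
  proof
    assume "(bot, t) \<in> \<Theta>"
    then have "(c t, top) \<in> \<Theta>" by (rule compatible_binary_singletons[OF minU _ reflI 2 1])
    then have "(c (c t), c top) \<in> \<Theta>" using compl by (auto simp: compatible_unary_def)
    then show "(t, bot) \<in> \<Theta>" by (simp add: compl_compl compl_top)
  next
    assume "(t, bot) \<in> \<Theta>"
    then have "(top, c t) \<in> \<Theta>" by (rule compatible_binary_singletons[OF minU _ reflI 1 2])
    then have "(c top, c (c t)) \<in> \<Theta>" using compl by (auto simp: compatible_unary_def)
    then show "(bot, t) \<in> \<Theta>" by (simp add: compl_compl compl_top)
  qed
qed

lemma greatest_related_bot:
  assumes "ascending_chain_condition TYPE('a)"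
  obtains e where "(e, bot) \<in> \<Theta>" "\<And>p. (p, bot) \<in> \<Theta> \<Longrightarrow> p \<le> e"
proof -
  have "bot \<in> {p. (p, bot) \<in> \<Theta>}" using reflI by simp
  from acc_maximal_element[OF assms this] obtain e
    where e: "(e, bot) \<in> \<Theta>" and max: "\<And>p. (p, bot) \<in> \<Theta> \<Longrightarrow> \<not> e < p" by blast
  have "p \<le> e" if p: "(p, bot) \<in> \<Theta>" for p
  proof -
    \<comment> \<open>Here \<open>s\<close> must be \<open>bot\<close>, so \<open>r\<close> is again
      related to \<open>bot\<close>; being above \<open>e\<close>, it equals \<open>e\<close> by
      maximality.\<close>
    obtain r s where r: "r \<in> MinU p e" "s \<in> MinU bot (bot::'a)" "(r, s) \<in> \<Theta>"
      by (rule compatible_binaryE[OF minU p e])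
    then have "(r, bot) \<in> \<Theta>" by (simp add: MinU_eq_right)
    then have "\<not> e < r" by (rule max)
    then show "p \<le> e" using MinU_upper[OF r(1)] by (auto simp: order.strict_iff_order)
  qed
  then show thesis using e that by blast
qed

text \<open>Meeting the pair with \<open>t\<close> leaves \<open>t\<close> on the left and
  \<open>bot\<close> on the right.\<close>

lemma disjoint_below_left_related_bot:
  assumes "(a, b) \<in> \<Theta>" "t \<le> a" "t \<le> c b"
  shows "(t, bot) \<in> \<Theta>"
proof -
  have "lower_bounds {b, t} = {bot}"
    using le_compl_imp_disjoint[OF order_refl assms(3)] .
  then have "MaxL b t = {bot}" by (rule MaxL_disjoint)
  moreover have "MaxL a t = {t}" by (rule MaxL_eq_right[OF assms(2)])
  ultimately show ?thesis
    by (rule compatible_binary_singletons[OF maxL assms(1) reflI, rotated])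
qed

text \<open>Symmetry of \<Theta> is not yet available, so the reversed pair is handled by
  \<open>related_bot_commute\<close>.\<close>

lemma disjoint_below_right_related_bot:
  assumes "(a, b) \<in> \<Theta>" "t \<le> b" "t \<le> c a"
  shows "(t, bot) \<in> \<Theta>"
proof -
  have "lower_bounds {a, t} = {bot}"
    using le_compl_imp_disjoint[OF order_refl assms(3)] .
  then have "MaxL a t = {bot}" by (rule MaxL_disjoint)
  moreover have "MaxL b t = {t}" by (rule MaxL_eq_right[OF assms(2)])
  ultimately have "(bot, t) \<in> \<Theta>"
    by (rule compatible_binary_singletons[OF maxL assms(1) reflI])
  then show ?thesis by (simp add: related_bot_commute)
qed

lemma related_iff_upper_bounds_eq:
  assumes e: "(e, bot) \<in> \<Theta>" and greatest: "\<And>p. (p, bot) \<in> \<Theta> \<Longrightarrow> p \<le> e"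
  shows "(y, z) \<in> \<Theta> \<longleftrightarrow> upper_bounds {y, e} = upper_bounds {z, e}"
proof -
  have forward: "upper_bounds {a, e} = upper_bounds {b, e}" if "(a, b) \<in> \<Theta>" for a b
    using disjoint_below_left_related_bot[OF that] disjoint_below_right_related_bot[OF that] greatest
    by (intro antisym upper_bounds_mono_of_difference) blast+
  have lub: "\<exists>m. upper_bounds {e, x} = upper_bounds {m} \<and> (m, x) \<in> \<Theta> \<and> (x, m) \<in> \<Theta>" for x
  proof -
    have x: "MinU bot x = {x}" by (simp add: MinU_eq_right)
    \<comment> \<open>Joining \<open>(e, bot)\<close> with \<open>(x, x)\<close> yields some minimal
      upper bound \<open>m\<close> related to \<open>x\<close>; \<open>forward\<close> then upgrades
      it to a least upper bound.\<close>
    obtain m where m: "m \<in> MinU e x" "(m, x) \<in> \<Theta>"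
      by (rule compatible_binaryE[OF minU e reflI[of x]]) (simp add: x)
    have "upper_bounds {m, e} = upper_bounds {m}"
      using MinU_upper[OF m(1)] by (auto simp: upper_bounds_def)
    then have U: "upper_bounds {e, x} = upper_bounds {m}"
      using forward[OF m(2)] by (simp add: insert_commute)
    have "(bot, e) \<in> \<Theta>" using e by (simp add: related_bot_commute)
    then have "(x, m) \<in> \<Theta>"
      by (rule compatible_binary_singletons[OF minU _ reflI x MinU_eq_lub[OF U]])
    then show ?thesis using U m(2) by blast
  qed
  have "(y, z) \<in> \<Theta>" if eq: "upper_bounds {y, e} = upper_bounds {z, e}"
  proof -
    obtain m where m: "upper_bounds {e, y} = upper_bounds {m}" "(y, m) \<in> \<Theta>" using lub by blast
    obtain n where n: "upper_bounds {e, z} = upper_bounds {n}" "(n, z) \<in> \<Theta>" using lub by blast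
    have "upper_bounds {m} = upper_bounds {n}" using m(1) n(1) eq by (simp add: insert_commute)
    then have "m = n" by (auto simp: upper_bounds_def set_eq_iff intro: antisym)
    have "y \<le> m" "z \<le> m" using m(1) n(1) \<open>m = n\<close> by (auto simp: upper_bounds_def set_eq_iff)
    \<comment> \<open>The common join \<open>m\<close> links \<open>y\<close> to \<open>z\<close>:
      meeting \<open>(y, m)\<close> with \<open>(m, z)\<close> gives \<open>(y, z)\<close>, in place
      of transitivity.\<close>
    then have "MaxL y m = {y}" "MaxL m z = {z}"
      by (simp_all add: MaxL_eq_left MaxL_eq_right)
    then show ?thesis
      by (rule compatible_binary_singletons[OF maxL m(2) n(2)[folded \<open>m = n\<close>]])
  qed
  then show ?thesis using forward by blast
qed

end

end

theorem theorem5p5: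
  fixes c :: "'a::{order_bot, order_top} \<Rightarrow> 'a"
    and T :: "'a \<Rightarrow> 'a \<Rightarrow> 'a \<Rightarrow> 'a set"
    and \<Theta> :: "('a \<times> 'a) set"
  assumes "boolean_poset c"
    and "ascending_chain_condition TYPE('a)"
    and "descending_chain_condition TYPE('a)"
    and "\<And>x y z. T x y z = minimal_elems (upper_bounds
          (maximal_elems (lower_bounds {x, z})
           \<union> maximal_elems (lower_bounds {x, c y, c z})
           \<union> maximal_elems (lower_bounds {c x, c y, z})))"
    and "refl \<Theta>"
    and "compatible_binary \<Theta> MaxL"
    and "compatible_binary \<Theta> MinU"
    and "compatible_unary \<Theta> c"
  shows "boolean_poset_congruence c \<Theta>"
proof -
  obtain e where "(e, bot) \<in> \<Theta>" "\<And>p. (p, bot) \<in> \<Theta> \<Longrightarrow> p \<le> e"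
    using greatest_related_bot[OF assms(1,5-8,2)] by blast
  note iff = related_iff_upper_bounds_eq[OF assms(1,5-8) this]
  \<comment> \<open>Symmetry and transitivity are inherited from equality of sets through
    \<open>iff\<close>.\<close>
  have "equiv UNIV \<Theta>"
    by (auto simp: equiv_def refl_on_def sym_def trans_def iff)
  then show ?thesis
    using assms(6-8) by (simp add: boolean_poset_congruence_def)
qed

end
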